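(* For each of the triples \[ (p,r,m)\in\{(5,3,2),\ (7,5,3),\ (11,10,5),\ (17,3,9),\ (19,5,10),\ (23,10,12),\ (29,20,15)\}, \] we have \[ \sum_{n=0}^\infty \mathcal{EO}_u (4pn+4r+2)q^n\equiv q^m\sum_{n=0}^\infty \mathcal{EO}_u (4n+2)q^{pn}\pmod{4}. \]
   Context: For a positive integer $k$, let $f_k:=(q^k;q^k)_\infty=\prod_{i=1}^\infty(1-q^{ki})$. The integers $\mathcal{EO}_u(n)$, $n\ge 0$, are defined by $\sum_{n=0}^\infty \mathcal{EO}_u(n)q^n=\dfrac{f_4^2}{f_2^2}$. A congruence between power series in $q$ with integer coefficients modulo $4$ means that the coefficients of each power of $q$ are congruent modulo $4$. *)

theory Defs
  imports "HOL-Analysis.Analysis" "HOL-Computational_Algebra.Formal_Power_Series" "HOL-Number_Theory.Cong"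
begin

text \<open>
  The infinite product is taken in the \<open>q\<close>-adic topology of the formal power series, with
  \<open>q\<close> written as \<^const>\<open>fps_X\<close>. It is only meaningful for \<open>k > 0\<close>; see \<open>euler_f_limit\<close> below.
\<close>

definition euler_f :: "nat \<Rightarrow> int fps" where
  "euler_f k = (\<Prod>i. 1 - fps_X ^ (k * Suc i))"

text \<open>
  Over the integers the quotient \<open>f\<^sub>4\<^sup>2 / f\<^sub>2\<^sup>2\<close> is the product with the multiplicative inverse of
  \<open>f\<^sub>2\<^sup>2\<close>, whose constant coefficient is the second argument \<open>1\<close> of \<open>fps_right_inverse\<close>;
  see \<open>EO_u_quotient\<close> below.
\<close>

definition EO_u :: "nat \<Rightarrow> int" where
  "EO_u n = fps_nth ((euler_f 4)\<^sup>2 * fps_right_inverse ((euler_f 2)\<^sup>2) 1) n"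

definition fps_cong :: "int \<Rightarrow> int fps \<Rightarrow> int fps \<Rightarrow> bool" where
  "fps_cong M F G \<longleftrightarrow> (\<forall>n. [fps_nth F n = fps_nth G n] (mod M))"

lemma euler_partial_nth_stable:
  fixes k n d :: nat
  assumes "k > 0"
  shows "fps_nth (\<Prod>i\<le>n + d. 1 - fps_X ^ (k * Suc i) :: int fps) n
       = fps_nth (\<Prod>i\<le>n. 1 - fps_X ^ (k * Suc i)) n"
proof (induction d)
  case (Suc d)
  define e where "e = k * Suc (Suc (n + d))"
  define Q :: "int fps" where "Q = (\<Prod>i\<le>n + d. 1 - fps_X ^ (k * Suc i))"
  have "n < e"
    using assms unfolding e_def by (cases k) auto
  have "(\<Prod>i\<le>n + Suc d. 1 - fps_X ^ (k * Suc i)) = Q * (1 - fps_X ^ e)"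
    unfolding Q_def e_def add_Suc_right by (rule prod.atMost_Suc)
  also have "fps_nth \<dots> n = fps_nth Q n"
    using \<open>n < e\<close> by (simp add: right_diff_distrib fps_X_power_mult_right_nth)
  finally show ?case
    using Suc unfolding Q_def by (rule trans)
qed (simp only: add_0_right)

lemma euler_partial_nth_0:
  fixes k n :: nat
  assumes "k > 0"
  shows "fps_nth (\<Prod>i\<le>n. 1 - fps_X ^ (k * Suc i) :: int fps) 0 = 1"
proof -
  have "fps_nth (1 - fps_X ^ (k * Suc i) :: int fps) 0 = 1" for i
    using assms by (simp add: fps_X_power_nth del: mult_Suc_right)
  then show ?thesis
    by (induction n) (simp_all del: mult_Suc_right fps_sub_nth)
qed

lemma euler_f_limit:
  assumes "k > 0"
  shows "(\<lambda>i. 1 - fps_X ^ (k * Suc i)) has_prod euler_f k" and "fps_nth (euler_f k) 0 = 1"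
proof -
  define P :: "nat \<Rightarrow> int fps" where "P n = (\<Prod>i\<le>n. 1 - fps_X ^ (k * Suc i))" for n
  define L :: "int fps" where "L = Abs_fps (\<lambda>n. fps_nth (P n) n)"
  have "eventually (\<lambda>m. fps_nth (P m) n = fps_nth L n) sequentially" for n
    using eventually_ge_at_top[of n]
  proof eventually_elim
    case (elim m)
    then have "fps_nth (P (n + (m - n))) n = fps_nth (P n) n"
      unfolding P_def by (intro euler_partial_nth_stable[OF assms])
    with elim show ?case
      by (simp add: L_def)
  qed
  then have lim: "P \<longlonglongrightarrow> L"
    by (intro tendsto_fpsI)
  have L0: "fps_nth L 0 = 1"
    unfolding L_def P_def fps_nth_Abs_fps by (rule euler_partial_nth_0[OF assms])
  then have "L \<noteq> 0"
    by auto
  with lim have prod: "(\<lambda>i. 1 - fps_X ^ (k * Suc i)) has_prod L"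
    unfolding has_prod_def raw_has_prod_def P_def add_0_right by blast
  have "euler_f k = L"
    unfolding euler_f_def using has_prod_unique[OF prod] by (rule sym)
  with prod L0 show "(\<lambda>i. 1 - fps_X ^ (k * Suc i)) has_prod euler_f k" "fps_nth (euler_f k) 0 = 1"
    by (simp_all only:)
qed

lemma EO_u_quotient: "(euler_f 2)\<^sup>2 * Abs_fps EO_u = (euler_f 4)\<^sup>2"
proof -
  define F G where "F = (euler_f 2)\<^sup>2" and "G = (euler_f 4)\<^sup>2"
  define H where "H = fps_right_inverse F 1"
  have "fps_nth F 0 * 1 = 1"
    unfolding F_def power2_eq_square fps_mult_nth_0 by (simp only: euler_f_limit(2) zero_less_numeral mult_1)
  then have "F * H = 1"
    unfolding H_def by (rule fps_right_inverse)
  moreover have "Abs_fps EO_u = G * H"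
    unfolding G_def H_def F_def by (rule fps_ext) (simp only: fps_nth_Abs_fps EO_u_def)
  ultimately have "F * Abs_fps EO_u = G"
    by (simp only: mult.left_commute[of F G H] mult_1_right)
  then show ?thesis
    unfolding F_def G_def .
qed

end

theory Submission
  imports Defs "HOL-Computational_Algebra.Formal_Laurent_Series" "HOL-Number_Theory.Residues"
begin

text \<open>
  Since \<open>1 - q\<^sup>2\<^sup>i = (1 - q\<^sup>i)\<^sup>2 (1 + 2q\<^sup>i / (1 - q\<^sup>i))\<close> and the number of divisors of \<open>n\<close> is odd
  exactly for squares, \<open>f\<^sub>2\<^sub>k \<equiv> f\<^sub>k\<^sup>2 (1 + 2 \<Sum>\<^sub>m q\<^bsup>km\<^sup>2\<^esup>) (mod 4)\<close> with the sum over \<open>m > 0\<close>.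
  Hence the generating function of \<^const>\<open>EO_u\<close> is \<open>f\<^sub>4 (1 + 2 \<Sum>\<^sub>m q\<^bsup>2m\<^sup>2\<^esup>)\<close> modulo 4. By the pentagonal number theorem,
  \<open>EO_u (4n + 2)\<close> is modulo 4 twice the number of positive solutions of \<open>x\<^sup>2 + 3z\<^sup>2 = 24n + 13\<close>.
  The theorem compares the parities of these numbers for \<open>pM\<close> and \<open>M / p\<close>, where \<open>pM = 24(pn + r) + 13\<close>:
  they agree because \<open>p\<close> is inert in \<open>\<int>[\<omega>]\<close> for \<open>p \<equiv> 2 (mod 3)\<close>, and because for \<open>p = 7, 19\<close> their
  sum is twice the number of positive solutions for \<open>M\<close>.
\<close>

subsection \<open>Power series modulo 4\<close>

text \<open>Infinite products are handled through finite ones, which match them only up to some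
  degree. Modulus 0 encodes plain equality of coefficients.\<close>

definition agree_upto :: "int \<Rightarrow> nat \<Rightarrow> int fps \<Rightarrow> int fps \<Rightarrow> bool" where
  "agree_upto M n F G \<longleftrightarrow> (\<forall>i\<le>n. [fps_nth F i = fps_nth G i] (mod M))"

lemma agree_upto_refl: "agree_upto M n F F"
  by (simp add: agree_upto_def)

lemma agree_upto_sym: "agree_upto M n F G \<Longrightarrow> agree_upto M n G F"
  by (simp add: agree_upto_def cong_sym_eq)

lemma agree_upto_trans [trans]:
  "agree_upto M n F G \<Longrightarrow> agree_upto M n G H \<Longrightarrow> agree_upto M n F H"
  by (meson agree_upto_def cong_trans)

lemma agree_upto_mult:
  "agree_upto M n F G \<Longrightarrow> agree_upto M n F' G' \<Longrightarrow> agree_upto M n (F * F') (G * G')"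
  by (auto simp: agree_upto_def fps_mult_nth intro!: cong_sum cong_mult)

lemma agree_upto_modulus_0: "agree_upto 0 n F G \<Longrightarrow> agree_upto M n F G"
  by (simp add: agree_upto_def cong_def)

lemma agree_upto_0_iff: "agree_upto 0 n F G \<longleftrightarrow> (\<forall>i\<le>n. fps_nth F i = fps_nth G i)"
  by (simp add: agree_upto_def cong_def)

lemma fps_cong_iff_agree_upto: "fps_cong M F G \<longleftrightarrow> (\<forall>n. agree_upto M n F G)"
  by (auto simp: fps_cong_def agree_upto_def)

text \<open>Series and counts that carry a factor 2 are needed only up to parity.\<close>

lemma cong_double:
  fixes a b :: int
  assumes "[a = b] (mod 2)"
  shows "[2 * a = 2 * b] (mod 4)"
proof -
  have "2 * 2 dvd 2 * (a - b)"
    using assms by (intro mult_dvd_mono dvd_refl) (simp add: cong_iff_dvd_diff)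
  then show ?thesis by (simp add: cong_iff_dvd_diff algebra_simps)
qed

text \<open>Later factors are 1 up to powers of q above \<open>n\<close>, so the low coefficients of
  the partial products are already those of the q-adic limit.\<close>

lemma euler_f_agree:
  assumes "k > 0" "n \<le> N"
  shows "agree_upto 0 n (euler_f k) (\<Prod>i\<in>{1..Suc N}. 1 - (fps_X ^ k) ^ i)"
  unfolding agree_upto_0_iff
proof safe
  fix i
  assume "i \<le> n"
  define P :: "nat \<Rightarrow> int fps" where "P m = (\<Prod>i\<le>m. 1 - fps_X ^ (k * Suc i))" for m
  have stable: "fps_nth (P m) i = fps_nth (P i) i" if "i \<le> m" for m
    unfolding P_def using euler_partial_nth_stable[OF assms(1), of i "m - i"] that by simp
  have "P \<longlonglongrightarrow> euler_f k"
    unfolding P_def by (rule has_prod_imp_tendsto) (rule euler_f_limit(1)[OF assms(1)])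
  then have "eventually (\<lambda>m. fps_nth (P m) i = fps_nth (euler_f k) i) sequentially"
    unfolding tendsto_fps_iff by blast
  then obtain m0 where "\<And>m. m \<ge> m0 \<Longrightarrow> fps_nth (P m) i = fps_nth (euler_f k) i"
    unfolding eventually_sequentially by blast
  \<comment> \<open>An index late enough both for the limit to be attained at degree
    \<open>i\<close> and for stability there.\<close>
  from this[of "max m0 i"] have "fps_nth (euler_f k) i = fps_nth (P i) i"
    using stable[of "max m0 i"] by simp
  also have "\<dots> = fps_nth (P N) i"
    using stable[of N] \<open>i \<le> n\<close> assms(2) by simp
  also have "P N = (\<Prod>i\<in>{1..Suc N}. 1 - (fps_X ^ k) ^ i)"
    unfolding P_def power_mult[symmetric]
    by (rule prod.reindex_bij_witness[of _ "\<lambda>i. i - 1" Suc]) auto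
  finally show "fps_nth (euler_f k) i = fps_nth (\<Prod>i\<in>{1..Suc N}. 1 - (fps_X ^ k) ^ i) i" .
qed

section \<open>The pentagonal number theorem\<close>

text \<open>Generalized pentagonal numbers, with \<open>j\<close> over all integers. The division is
  exact and the value nonnegative, so \<open>nat\<close> and \<open>div\<close> lose
  nothing.\<close>

definition pent :: "int \<Rightarrow> nat" where
  "pent j = nat (j * (3 * j - 1) div 2)"

lemma two_pent: "2 * int (pent j) = j * (3 * j - 1)"
proof -
  have "j * (3 * j - 1) \<ge> 0"
    by (cases "j \<ge> 1") (auto simp: zero_le_mult_iff)
  then show ?thesis unfolding pent_def by simp
qed

text \<open>Confines the indices \<open>j\<close> that contribute to a given coefficient to a finite
  interval.\<close>

lemma abs_le_pent: "\<bar>j\<bar> \<le> int (pent j)"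
proof -
  have "2 * \<bar>j\<bar> \<le> j * (3 * j - 1)"
  proof (cases "j \<ge> 1")
    case True
    then have "j * 2 \<le> j * (3 * j - 1)" by (intro mult_left_mono) auto
    with True show ?thesis by simp
  next
    case False
    show ?thesis
    proof (cases "j = 0")
      case False
      with \<open>\<not> j \<ge> 1\<close> have "(-j) * 2 \<le> (-j) * (1 - 3 * j)" by (intro mult_left_mono) auto
      with \<open>\<not> j \<ge> 1\<close> show ?thesis by (simp add: algebra_simps)
    qed simp
  qed
  then show ?thesis using two_pent[of j] by linarith
qed

text \<open>The shape in which the two new exponents appear in the induction for Shanks's
  identity.\<close>

lemma pent_of_nat:
  "pent (int (Suc n)) = Suc n * Suc n + n * Suc n div 2"
  "pent (- int n) = n * n + n * Suc n div 2"
proof -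
  have pentI: "pent j = a" if "2 * int a = j * (3 * j - 1)" for j a
    using that two_pent[of j] by linarith
  have "even (n * Suc n)" by simp
  then obtain t where t: "n * Suc n = 2 * t" by blast
  then have "n * Suc n div 2 = t" by simp
  moreover have "2 * int t = int n * (int n + 1)"
    using arg_cong[OF t, of int] by (simp add: algebra_simps)
  ultimately show "pent (int (Suc n)) = Suc n * Suc n + n * Suc n div 2"
    and "pent (- int n) = n * n + n * Suc n div 2"
    by (intro pentI; simp add: algebra_simps)+
qed

text \<open>
  Shanks's finite form of the pentagonal number theorem. On the left, only the term \<open>s = 0\<close>
  contributes to the powers of \<open>x\<close> up to \<open>n\<close>.
\<close>

lemma shanks_pentagonal:
  fixes x :: "'a :: comm_ring_1"
  shows "(\<Sum>s\<le>n. (-1) ^ s * (\<Prod>i\<in>{Suc s..n}. 1 - x ^ i) * x ^ (s * n + s * Suc s div 2))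
       = (\<Sum>j\<in>{- int n..int n}. (-1) ^ nat \<bar>j\<bar> * x ^ pent j)"
proof (induction n)
  case 0
  then show ?case by (simp add: pent_def)
next
  case (Suc n)
  define Q where "Q s = (\<Prod>i\<in>{Suc s..n}. 1 - x ^ i)" for s
  define T where "T s = s * Suc s div 2" for s :: nat
  \<comment> \<open>\<open>A s\<close> is the summand for \<open>n\<close>; for
    \<open>s \<le> n\<close> the summand for \<open>Suc n\<close> equals
    \<open>A s * x ^ s - B s\<close>.\<close>
  define A where "A s = (-1) ^ s * Q s * x ^ (s * n + T s)" for s
  define B where "B s = (-1) ^ s * Q s * x ^ (Suc s * Suc n + T s)" for s
  have T: "T (Suc s) = T s + Suc s" for s unfolding T_def by simp
  have Qn: "Q n = 1" unfolding Q_def by simp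
  have Qs: "Q s = (1 - x ^ Suc s) * Q (Suc s)" if "s < n" for s
    unfolding Q_def using that by (simp add: prod.atLeast_Suc_atMost)
  have Q': "(\<Prod>i\<in>{Suc s..Suc n}. 1 - x ^ i) = Q s * (1 - x ^ Suc n)" if "s \<le> n" for s
    unfolding Q_def using that by simp
  have "(\<Sum>s\<le>Suc n. (-1) ^ s * (\<Prod>i\<in>{Suc s..Suc n}. 1 - x ^ i) * x ^ (s * Suc n + T s))
      = (\<Sum>s\<le>n. (-1) ^ s * (Q s * (1 - x ^ Suc n)) * x ^ (s * Suc n + T s))
        + (-1) ^ Suc n * x ^ (Suc n * Suc n + T (Suc n))"
    unfolding sum.atMost_Suc
    by (intro arg_cong2[of _ _ _ _ "(+)"] sum.cong refl)
      (simp_all add: Q' del: prod.cl_ivl_Suc power_Suc mult_Suc_right mult_Suc)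
  also have "(\<Sum>s\<le>n. (-1) ^ s * (Q s * (1 - x ^ Suc n)) * x ^ (s * Suc n + T s))
      = (\<Sum>s\<le>n. A s - A s * (1 - x ^ s) - B s)"
    by (intro sum.cong refl) (simp add: A_def B_def algebra_simps power_add)
  also have "\<dots> = (\<Sum>s\<le>n. A s) - (\<Sum>s\<le>n. A s * (1 - x ^ s)) - (\<Sum>s\<le>n. B s)"
    by (simp add: sum_subtractf)
  \<comment> \<open>The term \<open>s = 0\<close> vanishes because of the factor
    \<open>1 - x ^ 0\<close>.\<close>
  also have "(\<Sum>s\<le>n. A s * (1 - x ^ s)) = (\<Sum>s<n. A (Suc s) * (1 - x ^ Suc s))"
    by (simp add: lessThan_Suc_atMost[symmetric] sum.lessThan_Suc_shift del: sum.lessThan_Suc)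
  \<comment> \<open>\<open>Q s\<close> has exactly the factor \<open>1 - x ^ Suc s\<close> more than
    \<open>Q (Suc s)\<close>. Hence the sums of \<open>B\<close> cancel and only \<open>B n\<close>
    survives.\<close>
  also have "\<dots> = (\<Sum>s<n. - B s)"
  proof (intro sum.cong refl)
    fix s
    assume "s \<in> {..<n}"
    then have "s < n" by simp
    have "Suc s * n + T (Suc s) = Suc s * Suc n + T s" by (simp add: T)
    moreover have "(-1) ^ Suc s * q * e * (1 - y) = - ((-1) ^ s * ((1 - y) * q) * e)" for q e y :: 'a
      by (simp add: algebra_simps)
    ultimately show "A (Suc s) * (1 - x ^ Suc s) = - B s"
      unfolding A_def B_def Qs[OF \<open>s < n\<close>] by (simp only:)
  qed
  also have "(\<Sum>s\<le>n. B s) = (\<Sum>s<n. B s) + B n"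
    by (simp add: lessThan_Suc_atMost[symmetric])
  also have "B n = (-1) ^ n * x ^ (Suc n * Suc n + T n)"
    by (simp add: B_def Qn)
  also have "(\<Sum>s\<le>n. A s) = (\<Sum>j\<in>{- int n..int n}. (-1) ^ nat \<bar>j\<bar> * x ^ pent j)"
    using Suc unfolding A_def Q_def T_def .
  \<comment> \<open>The two leftover terms are those of \<open>j = n + 1\<close> and
    \<open>j = -(n + 1)\<close>.\<close>
  also have "Suc n * Suc n + T n = pent (int (Suc n))"
    unfolding pent_of_nat T_def ..
  also have "Suc n * Suc n + T (Suc n) = pent (- int (Suc n))"
    unfolding pent_of_nat T_def ..
  finally have "(\<Sum>s\<le>Suc n. (-1) ^ s * (\<Prod>i\<in>{Suc s..Suc n}. 1 - x ^ i) * x ^ (s * Suc n + T s))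
      = (\<Sum>j\<in>{- int n..int n}. (-1) ^ nat \<bar>j\<bar> * x ^ pent j)
        + (-1) ^ Suc n * x ^ pent (int (Suc n)) + (-1) ^ Suc n * x ^ pent (- int (Suc n))"
    by (simp add: sum_negf)
  also have "\<dots> = (\<Sum>j\<in>insert (int (Suc n)) (insert (- int (Suc n)) {- int n..int n}). (-1) ^ nat \<bar>j\<bar> * x ^ pent j)"
    by (simp add: nat_add_distrib algebra_simps)
  also have "insert (int (Suc n)) (insert (- int (Suc n)) {- int n..int n}) = {- int (Suc n)..int (Suc n)}"
    by auto
  finally show ?case unfolding T_def .
qed

text \<open>Shanks's identity at \<open>x = q^k\<close> with \<open>N = n + 1\<close>: every term
  with \<open>s > 0\<close> on its left side is divisible by \<open>q^(k N)\<close>, which lies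
  beyond degree \<open>n\<close>, and the term \<open>s = 0\<close> is the truncated
  product.\<close>

lemma euler_f_nth:
  assumes "k > 0"
  shows "fps_nth (euler_f k) n = (\<Sum>j | k * pent j = n. (-1) ^ nat \<bar>j\<bar>)"
proof -
  define N where "N = Suc n"
  define x :: "int fps" where "x = fps_X ^ k"
  define R where "R s = (\<Prod>i\<in>{Suc s..N}. 1 - x ^ i)" for s
  have "agree_upto 0 n (euler_f k) (R 0)"
    using euler_f_agree[OF assms order_refl[of n]] by (simp add: R_def x_def N_def)
  then have "fps_nth (euler_f k) n = fps_nth (R 0) n"
    by (simp add: agree_upto_def)
  also have "\<dots> = fps_nth (\<Sum>s\<le>N. (-1) ^ s * R s * x ^ (s * N + s * Suc s div 2)) n"
  proof -
    have "fps_nth ((-1) ^ Suc s * R (Suc s) * x ^ (Suc s * N + Suc s * Suc (Suc s) div 2)) n = 0" for s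
    proof -
      have "n < 1 * (1 * N + 0)" by (simp add: N_def)
      also have "\<dots> \<le> k * (Suc s * N + Suc s * Suc (Suc s) div 2)"
        using assms by (intro mult_mono add_mono) auto
      finally show ?thesis
        unfolding x_def power_mult[symmetric] by (simp only: fps_X_power_mult_right_nth if_True)
    qed
    then show ?thesis
      unfolding sum.atMost_shift by (simp add: fps_sum_nth del: power_Suc mult_Suc mult_Suc_right)
  qed
  also have "\<dots> = fps_nth (\<Sum>j\<in>{- int N..int N}. (-1) ^ nat \<bar>j\<bar> * x ^ pent j) n"
    unfolding R_def shanks_pentagonal ..
  also have "\<dots> = (\<Sum>j\<in>{- int N..int N}. if k * pent j = n then (-1) ^ nat \<bar>j\<bar> else 0)"
  proof -
    have "fps_nth ((-1) ^ m * x ^ e) n = (if k * e = n then (-1) ^ m else 0)" for m e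
    proof -
      have c: "(-1) ^ m = fps_const ((-1) ^ m :: int)"
        by (simp flip: fps_const_power fps_const_neg)
      show ?thesis
        unfolding c x_def power_mult[symmetric] by (simp add: fps_X_power_nth)
    qed
    then show ?thesis unfolding fps_sum_nth by simp
  qed
  also have "\<dots> = (\<Sum>j | k * pent j = n. (-1) ^ nat \<bar>j\<bar>)"
  proof -
    have "j \<in> {- int N..int N}" if "k * pent j = n" for j
    proof -
      have "\<bar>j\<bar> \<le> int (pent j)" by (rule abs_le_pent)
      moreover have "pent j \<le> k * pent j" using assms by simp
      ultimately show ?thesis using that unfolding N_def atLeastAtMost_iff by linarith
    qed
    then have *: "{j. k * pent j = n} = {j \<in> {- int N..int N}. k * pent j = n}" by blast
    show ?thesis unfolding * by (rule sum.inter_filter[symmetric]) simp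
  qed
  finally show ?thesis .
qed

section \<open>Reduction of the generating function modulo 4\<close>

text \<open>The involution \<open>d \<mapsto> n div d\<close> pairs the divisors below the square
  root of \<open>n\<close> with those above it; only a divisor with \<open>d * d = n\<close> stays
  unpaired.\<close>

lemma odd_card_divisors_iff:
  assumes "(n::nat) > 0"
  shows "odd (card {d. d dvd n}) \<longleftrightarrow> (\<exists>m. n = m\<^sup>2)"
proof -
  define L where "L = {d. d dvd n \<and> d * d < n}"
  define U where "U = {d. d dvd n \<and> n < d * d}"
  define E where "E = {d. d dvd n \<and> d * d = n}"
  have fin: "finite L" "finite U" "finite E"
    using assms by (auto simp: L_def U_def E_def)
  have flip: "n div d dvd n \<and> n div (n div d) = d \<and> ((n div d) * (n div d) < n \<longleftrightarrow> n < d * d)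
      \<and> (n < (n div d) * (n div d) \<longleftrightarrow> d * d < n)" if "d dvd n" for d
  proof -
    from that obtain e where e: "n = d * e" by blast
    with assms have pos: "d > 0" "e > 0" by auto
    then show ?thesis unfolding e by simp
  qed
  have "bij_betw (\<lambda>d. n div d) L U"
    by (rule bij_betw_byWitness[where f' = "\<lambda>d. n div d"]) (auto simp: L_def U_def flip)
  then have "card L = card U" by (rule bij_betw_same_card)
  moreover have "card {d. d dvd n} = card L + card U + card E"
  proof -
    have "{d. d dvd n} = L \<union> U \<union> E" by (auto simp: L_def U_def E_def)
    moreover have "L \<inter> U = {}" "(L \<union> U) \<inter> E = {}" by (auto simp: L_def U_def E_def)
    ultimately show ?thesis using fin by (simp add: card_Un_disjoint)
  qed
  moreover have "odd (card E) \<longleftrightarrow> (\<exists>m. n = m\<^sup>2)"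
  proof (cases "\<exists>m. n = m\<^sup>2")
    case True
    then obtain m where m: "n = m\<^sup>2" by blast
    have "E = {m}" unfolding E_def m by (auto simp: power2_eq_square[symmetric])
    with True show ?thesis by simp
  next
    case False
    then have "E = {}" unfolding E_def by (auto simp: power2_eq_square)
    with False show ?thesis by simp
  qed
  ultimately show ?thesis by simp
qed

text \<open>Each factor of \<open>f_2k\<close> is \<open>(1 - x^i)(1 + x^i)\<close>, and
  \<open>1 + x^i = (1 - x^i)(1 + 2 L_i)\<close>. Modulo 4 the product of the
  \<open>1 + 2 L_i\<close> is linear in the \<open>L_i\<close>, whose sum counts divisors.\<close>

lemma euler_f_double_cong:
  assumes "k > 0"
  shows "fps_cong 4 (euler_f (2 * k))
           ((euler_f k)\<^sup>2 * (1 + 2 * Abs_fps (\<lambda>n. of_bool (\<exists>m>0. n = k * m\<^sup>2))))"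
  unfolding fps_cong_iff_agree_upto
proof
  fix n
  define x :: "int fps" where "x = fps_X ^ k"
  define I where "I = {1..Suc n}"
  \<comment> \<open>The geometric series \<open>x^i / (1 - x^i)\<close>; the condition
    \<open>n > 0\<close> removes its constant term.\<close>
  define L where "L i = Abs_fps (\<lambda>n. of_bool (n > 0 \<and> k * i dvd n) :: int)" for i
  define \<Theta> where "\<Theta> = Abs_fps (\<lambda>n. of_bool (\<exists>m>0. n = k * m\<^sup>2) :: int)"
  have "finite I" by (simp add: I_def)
  have fk: "agree_upto 4 n (euler_f k) (\<Prod>i\<in>I. 1 - x ^ i)"
    using agree_upto_modulus_0[OF euler_f_agree[OF assms order_refl[of n]]] by (simp add: I_def x_def)
  have lin: "(1 - x ^ i) * (1 + 2 * L i) = 1 + x ^ i" if "i \<in> I" for i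
  proof -
    have "k * i > 0" using assms that by (auto simp: I_def)
    have "(1 - x ^ i) * L i = x ^ i"
    proof (rule fps_ext)
      fix j
      have "fps_nth ((1 - x ^ i) * L i) j = fps_nth (L i) j - (if j < k * i then 0 else fps_nth (L i) (j - k * i))"
        unfolding x_def power_mult[symmetric] by (simp add: left_diff_distrib fps_X_power_mult_nth)
      \<comment> \<open>Neighbouring coefficients cancel except at the first multiple, where the
        predecessor is the missing constant term.\<close>
      also have "\<dots> = of_bool (j = k * i)"
        using \<open>k * i > 0\<close> by (auto simp: L_def dvd_minus_self dest: dvd_imp_le)
      finally show "fps_nth ((1 - x ^ i) * L i) j = fps_nth (x ^ i) j"
        unfolding x_def power_mult[symmetric] by (simp add: fps_X_power_nth)
    qed
    then have "(1 - x ^ i) * (1 + 2 * L i) = (1 - x ^ i) + 2 * x ^ i"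
      by (simp only: distrib_left mult.left_commute[of _ 2] mult_1_right)
    then show ?thesis by simp
  qed
  \<comment> \<open>Products of two terms \<open>2 * L i\<close> carry a factor 4.\<close>
  have expand: "agree_upto 4 n (\<Prod>i\<in>J. 1 + 2 * L i) (1 + 2 * (\<Sum>i\<in>J. L i))" if "finite J" for J
    using that
  proof induction
    case empty
    then show ?case by (simp add: agree_upto_refl)
  next
    case (insert j J)
    have "agree_upto 4 n ((1 + 2 * L j) * (\<Prod>i\<in>J. 1 + 2 * L i)) ((1 + 2 * L j) * (1 + 2 * (\<Sum>i\<in>J. L i)))"
      by (rule agree_upto_mult[OF agree_upto_refl insert.IH])
    also have "(1 + 2 * L j) * (1 + 2 * (\<Sum>i\<in>J. L i))
        = (1 + 2 * (L j + (\<Sum>i\<in>J. L i))) + fps_const 4 * (L j * (\<Sum>i\<in>J. L i))"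
      by (simp add: algebra_simps numeral_fps_const[symmetric])
    also have "agree_upto 4 n \<dots> (1 + 2 * (L j + (\<Sum>i\<in>J. L i)))"
      unfolding agree_upto_def fps_add_nth[of _ "fps_const 4 * _"] fps_mult_left_const_nth by (simp add: cong_def)
    finally show ?case using insert.hyps by simp
  qed
  have theta: "agree_upto 4 n (1 + 2 * (\<Sum>i\<in>I. L i)) (1 + 2 * \<Theta>)"
  proof -
    have "[fps_nth (\<Sum>i\<in>I. L i) j = fps_nth \<Theta> j] (mod 2)" if "j \<le> n" for j
    proof -
      have "fps_nth (\<Sum>i\<in>I. L i) j = (\<Sum>i\<in>I. of_bool (j > 0 \<and> k * i dvd j))"
        by (simp add: fps_sum_nth L_def)
      also have "\<dots> = int (card {i\<in>I. j > 0 \<and> k * i dvd j})"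
        using \<open>finite I\<close> by (simp add: sum_of_bool_eq Int_def)
      also have "[\<dots> = fps_nth \<Theta> j] (mod 2)"
      proof (cases "j > 0 \<and> k dvd j")
        case False
        then have "{i\<in>I. j > 0 \<and> k * i dvd j} = {}" by (auto dest: dvd_mult_left)
        moreover have "fps_nth \<Theta> j = 0" using False assms by (auto simp: \<Theta>_def)
        ultimately show ?thesis by (simp only: card.empty of_nat_0 cong_refl)
      next
        case True
        then obtain l where l: "j = k * l" by blast
        with True assms have "l > 0" by auto
        have "l \<le> n" using l that assms by (metis mult_le_mono1 nat_mult_1 order_trans Suc_leI One_nat_def)
        \<comment> \<open>As \<open>l \<le> n\<close>, the range \<open>I\<close> contains all
          divisors of \<open>l\<close>.\<close>
        have "{i\<in>I. j > 0 \<and> k * i dvd j} = {d. d dvd l}"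
          using \<open>l > 0\<close> \<open>l \<le> n\<close> True assms by (auto simp: l I_def Suc_le_eq dvd_pos_nat dest: dvd_imp_le)
        moreover have "fps_nth \<Theta> j = of_bool (\<exists>m. l = m\<^sup>2)"
          using \<open>l > 0\<close> assms by (auto simp: \<Theta>_def l)
        ultimately show ?thesis
          using odd_card_divisors_iff[OF \<open>l > 0\<close>] by (auto simp: cong_def of_nat_mod mod2_eq_if)
      qed
      finally show ?thesis .
    qed
    then have "[2 * fps_nth (\<Sum>i\<in>I. L i) j = 2 * fps_nth \<Theta> j] (mod 4)" if "j \<le> n" for j
      using that by (intro cong_double)
    then show ?thesis
      by (auto simp: agree_upto_def numeral_fps_const intro!: cong_add)
  qed
  have "agree_upto 0 n (euler_f (2 * k)) (\<Prod>i\<in>I. 1 - (fps_X ^ (2 * k)) ^ i)"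
    using assms unfolding I_def by (intro euler_f_agree) auto
  then have "agree_upto 4 n (euler_f (2 * k)) (\<Prod>i\<in>I. 1 - (fps_X ^ (2 * k)) ^ i)"
    by (rule agree_upto_modulus_0)
  also have "(\<Prod>i\<in>I. 1 - (fps_X ^ (2 * k)) ^ i) = (\<Prod>i\<in>I. (1 - x ^ i) * (1 - x ^ i) * (1 + 2 * L i))"
  proof (intro prod.cong refl)
    fix i
    assume "i \<in> I"
    have "(fps_X ^ (2 * k)) ^ i = x ^ i * x ^ i"
      by (simp add: x_def power_mult[symmetric] power_add[symmetric] algebra_simps)
    then have "1 - (fps_X ^ (2 * k)) ^ i = (1 - x ^ i) * (1 + x ^ i)"
      by (simp add: algebra_simps)
    then show "1 - (fps_X ^ (2 * k)) ^ i = (1 - x ^ i) * (1 - x ^ i) * (1 + 2 * L i)"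
      unfolding mult.assoc lin[OF \<open>i \<in> I\<close>] .
  qed
  also have "\<dots> = (\<Prod>i\<in>I. 1 - x ^ i) * (\<Prod>i\<in>I. 1 - x ^ i) * (\<Prod>i\<in>I. 1 + 2 * L i)"
    by (simp add: prod.distrib)
  also have "agree_upto 4 n \<dots> (euler_f k * euler_f k * (1 + 2 * \<Theta>))"
    by (intro agree_upto_mult agree_upto_sym[OF fk] agree_upto_trans[OF expand theta]) (simp add: I_def)
  finally show "agree_upto 4 n (euler_f (2 * k)) ((euler_f k)\<^sup>2 * (1 + 2 * \<Theta>))"
    by (simp add: power2_eq_square)
qed

text \<open>Only one of the two factors \<open>f_4\<close> is rewritten, as \<open>f_2^2\<close>
  times the theta factor. This cancels the denominator and leaves an \<open>f_4\<close> for the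
  pentagonal number theorem.\<close>

lemma EO_u_cong:
  "fps_cong 4 (Abs_fps EO_u) (euler_f 4 * (1 + 2 * Abs_fps (\<lambda>n. of_bool (\<exists>m>0. n = 2 * m\<^sup>2))))"
  unfolding fps_cong_iff_agree_upto
proof
  fix n
  define T where "T = 1 + 2 * Abs_fps (\<lambda>n. of_bool (\<exists>m>0. n = 2 * m\<^sup>2) :: int)"
  define F where "F = (euler_f 2)\<^sup>2"
  define H where "H = fps_right_inverse F 1"
  have "fps_nth F 0 * 1 = 1"
    by (simp add: F_def power2_eq_square euler_f_limit(2))
  then have inv: "H * F = 1"
    unfolding H_def by (metis fps_right_inverse mult.commute)
  have "agree_upto 4 n (euler_f 4) (F * T)"
    using euler_f_double_cong[of 2] by (simp add: F_def T_def fps_cong_iff_agree_upto)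
  then have "agree_upto 4 n (H * (euler_f 4 * euler_f 4)) (H * (euler_f 4 * (F * T)))"
    by (intro agree_upto_mult agree_upto_refl)
  also have "H * (euler_f 4 * (F * T)) = (H * F) * (euler_f 4 * T)"
    by (simp only: ac_simps)
  finally have "agree_upto 4 n (H * (euler_f 4)\<^sup>2) (euler_f 4 * T)"
    by (simp only: inv mult_1 power2_eq_square)
  moreover have "H * (euler_f 4)\<^sup>2 = (H * F) * Abs_fps EO_u"
    unfolding EO_u_quotient[symmetric] F_def by (simp only: ac_simps)
  ultimately show "agree_upto 4 n (Abs_fps EO_u) (euler_f 4 * T)"
    by (simp only: inv mult_1)
qed

subsection \<open>Representations by \<open>x\<^sup>2 + 3z\<^sup>2\<close>\<close>

text \<open>The elements \<open>x + z sqrt(-3)\<close> of norm \<open>N\<close>. Signed solutions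
  suit the multiplicative argument, whereas \<open>EO_u\<close> leads to positive ones.\<close>

definition reps :: "int \<Rightarrow> (int \<times> int) set" where
  "reps N = {(x, z). x\<^sup>2 + 3 * z\<^sup>2 = N}"

definition pos_reps :: "int \<Rightarrow> (int \<times> int) set" where
  "pos_reps N = {(x, z). x > 0 \<and> z > 0 \<and> x\<^sup>2 + 3 * z\<^sup>2 = N}"

lemma finite_reps: "finite (reps N)"
proof (rule finite_subset)
  show "reps N \<subseteq> {-\<bar>N\<bar>..\<bar>N\<bar>} \<times> {-\<bar>N\<bar>..\<bar>N\<bar>}"
  proof clarify
    fix x z :: int
    assume "(x, z) \<in> reps N"
    then have N: "x\<^sup>2 + 3 * z\<^sup>2 = N"
      by (simp add: reps_def)
    have "\<bar>y\<bar> \<le> y\<^sup>2" for y :: int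
      using self_le_power[of "\<bar>y\<bar>" 2] by (cases "y = 0") auto
    from this[of x] this[of z] have "\<bar>x\<bar> \<le> N" "\<bar>z\<bar> \<le> N"
      using N zero_le_power2[of x] zero_le_power2[of z] by linarith+
    then show "x \<in> {-\<bar>N\<bar>..\<bar>N\<bar>} \<and> z \<in> {-\<bar>N\<bar>..\<bar>N\<bar>}"
      by auto
  qed
qed simp

text \<open>Without zero coordinates, every solution comes from exactly one positive solution and
  one choice of two signs.\<close>

lemma card_reps:
  assumes "\<And>x z. (x, z) \<in> reps N \<Longrightarrow> x \<noteq> 0 \<and> z \<noteq> 0"
  shows "card (reps N) = 4 * card (pos_reps N)"
proof -
  define S :: "(int \<times> int) set" where "S = {-1, 1} \<times> {-1, 1}"
  define f :: "(int \<times> int) \<times> (int \<times> int) \<Rightarrow> int \<times> int"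
    where "f = (\<lambda>((x, z), (s, t)). (s * x, t * z))"
  have inj: "inj_on f (pos_reps N \<times> S)"
    by (auto simp: inj_on_def f_def S_def pos_reps_def)
  have "reps N \<subseteq> f ` (pos_reps N \<times> S)"
  proof clarify
    fix x z :: int
    assume xz: "(x, z) \<in> reps N"
    with assms have nz: "x \<noteq> 0" "z \<noteq> 0" by auto
    have "(x, z) = f ((\<bar>x\<bar>, \<bar>z\<bar>), (sgn x, sgn z))"
      by (simp add: f_def sgn_mult_abs)
    moreover have "(\<bar>x\<bar>, \<bar>z\<bar>) \<in> pos_reps N" "(sgn x, sgn z) \<in> S"
      using xz nz by (auto simp: reps_def pos_reps_def S_def sgn_if)
    ultimately show "(x, z) \<in> f ` (pos_reps N \<times> S)" by blast
  qed
  moreover have "f ` (pos_reps N \<times> S) \<subseteq> reps N"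
    by (auto simp: f_def S_def reps_def pos_reps_def)
  ultimately have "reps N = f ` (pos_reps N \<times> S)" by blast
  with inj have "card (reps N) = card (pos_reps N \<times> S)"
    by (simp add: card_image)
  also have "\<dots> = 4 * card (pos_reps N)"
    by (simp add: card_cartesian_product S_def)
  finally show ?thesis .
qed

section \<open>Inert primes\<close>

lemma fermat_int:
  fixes p :: nat and a :: int
  assumes "prime p" and "\<not> int p dvd a"
  shows "[a ^ (p - 1) = 1] (mod int p)"
proof -
  define b where "b = nat (a mod int p)"
  have p: "p > 0" using assms(1) prime_gt_0_nat by blast
  have b: "int b = a mod int p" using p by (simp add: b_def)
  have "\<not> p dvd b"
    using assms(2) b by (metis int_dvd_int_iff dvd_mod_iff dvd_refl)
  then have "[b ^ (p - 1) = 1] (mod p)" using fermat_theorem assms(1) by blast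
  then have "[int b ^ (p - 1) = 1] (mod int p)"
    by (metis cong_int_iff of_nat_1 of_nat_power)
  moreover have "[a ^ (p - 1) = int b ^ (p - 1)] (mod int p)"
    unfolding b by (intro cong_pow) (simp add: cong_def)
  ultimately show ?thesis by (rule cong_trans[rotated])
qed

text \<open>As \<open>p - 1 = 3 k + 1\<close>, Fermat's theorem makes \<open>(a ^ 3) ^ k\<close> an
  inverse of \<open>a\<close>, so the cube of a nonzero residue determines it.\<close>

lemma cube_inj_mod_prime:
  fixes p :: nat and a b :: int
  assumes p: "prime p" and p3: "p mod 3 = 2" and ab: "[a ^ 3 = b ^ 3] (mod int p)"
  shows "[a = b] (mod int p)"
proof (cases "int p dvd a")
  case True
  then have "int p dvd a ^ 3" by (simp add: power3_eq_cube)
  with ab have "int p dvd b ^ 3" using cong_dvd_iff by blast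
  with p have "int p dvd b" using prime_dvd_power[of "int p"] by simp
  with True show ?thesis by (simp add: cong_iff_dvd_diff)
next
  case False
  have b: "\<not> int p dvd b"
  proof
    assume "int p dvd b"
    then have "int p dvd b ^ 3" by (simp add: power3_eq_cube)
    with ab have "int p dvd a ^ 3" using cong_dvd_iff by blast
    with p False show False using prime_dvd_power[of "int p"] by simp
  qed
  define k where "k = p div 3"
  have k: "p - 1 = Suc (3 * k)"
    using p3 unfolding k_def by presburger
  define c where "c = (b ^ 3) ^ k"
  have "[a * (a ^ 3) ^ k = 1] (mod int p)" "[b * c = 1] (mod int p)"
    using fermat_int[OF p False] fermat_int[OF p b] unfolding k c_def power_Suc power_mult .
  moreover have "[a * (a ^ 3) ^ k = a * c] (mod int p)"
    unfolding c_def by (intro cong_mult cong_pow ab cong_refl)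
  ultimately have "[a * c = b * c] (mod int p)"
    by (meson cong_sym cong_trans)
  moreover have "coprime c (int p)"
  proof -
    have "\<not> int p dvd c"
      unfolding c_def using b p by (metis prime_dvd_power prime_nat_int_transfer)
    then show ?thesis
      using p prime_imp_coprime[of "int p" c] by (simp add: coprime_commute)
  qed
  ultimately show ?thesis
    by (simp add: cong_mult_rcancel)
qed

text \<open>If \<open>x\<^sup>2 \<equiv> -3z\<^sup>2\<close>, then \<open>(x - z)\<^sup>3 \<equiv> (2z)\<^sup>3\<close>: up to the factor \<open>2z\<close>, \<open>x - z\<close> is a cube root of unity.\<close>

lemma inert_dvd:
  fixes p :: nat and x z :: int
  assumes p: "prime p" "p mod 3 = 2" "p > 2" and dvd: "int p dvd x\<^sup>2 + 3 * z\<^sup>2"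
  shows "int p dvd x \<and> int p dvd z"
proof -
  have "(x - z) ^ 3 - (2 * z) ^ 3 = (x\<^sup>2 + 3 * z\<^sup>2) * (x - 3 * z)"
    by (simp add: power2_eq_square power3_eq_cube algebra_simps)
  with dvd have "[(x - z) ^ 3 = (2 * z) ^ 3] (mod int p)"
    by (simp add: cong_iff_dvd_diff)
  then have "[x - z = 2 * z] (mod int p)"
    by (rule cube_inj_mod_prime[OF p(1,2)])
  then have x: "int p dvd x - 3 * z"
    by (simp add: cong_iff_dvd_diff)
  \<comment> \<open>From \<open>x \<equiv> 3 z\<close> the form becomes \<open>12 z^2\<close>, and
    \<open>p\<close> differs from 2 and 3.\<close>
  have "12 * z\<^sup>2 = (x\<^sup>2 + 3 * z\<^sup>2) - (x - 3 * z) * (x + 3 * z)"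
    by (simp add: power2_eq_square algebra_simps)
  then have "int p dvd 12 * z\<^sup>2"
    by (simp only: dvd_diff[OF dvd dvd_mult2[OF x]])
  moreover have "\<not> int p dvd 12"
  proof
    assume "int p dvd 12"
    then have "p dvd 2 * (2 * 3)" by presburger
    with p(1) have "p dvd 2 \<or> p dvd 3" by (metis prime_dvd_mult_iff)
    then have "p \<le> 3" by (auto dest: dvd_imp_le)
    with p(2,3) show False by (cases "p = 3") auto
  qed
  ultimately have "int p dvd z\<^sup>2"
    using p(1) prime_dvd_mult_iff[of "int p" 12 "z\<^sup>2"] by simp
  then have z: "int p dvd z"
    using p(1) prime_dvd_power[of "int p" z 2] by simp
  with dvd_add[OF x dvd_mult[OF z, of 3]] show ?thesis
    by simp
qed

text \<open>By \<open>inert_dvd\<close> both coordinates of a solution are divisible by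
  \<open>p\<close>. So \<open>p^2\<close> divides \<open>p M\<close> if there is a solution at all,
  and division by \<open>p\<close> is a bijection onto the solutions for
  \<open>M / p\<close>.\<close>

lemma pos_reps_inert:
  fixes p :: nat
  assumes p: "prime p" "p mod 3 = 2" "p > 2"
  shows "card (pos_reps (int p * M)) = (if int p dvd M then card (pos_reps (M div int p)) else 0)"
proof -
  have P: "int p > 0" using p by simp
  show ?thesis
  proof (cases "int p dvd M")
    case True
    then obtain L where L: "M = int p * L" by blast
    have "pos_reps (int p * M) = (\<lambda>(x, z). (int p * x, int p * z)) ` pos_reps L"
    proof (intro equalityI subsetI)
      fix w
      assume "w \<in> pos_reps (int p * M)"
      then obtain x z where w: "w = (x, z)" and xz: "x > 0" "z > 0" "x\<^sup>2 + 3 * z\<^sup>2 = int p * M"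
        by (auto simp: pos_reps_def)
      then have "int p dvd x \<and> int p dvd z"
        by (intro inert_dvd p) simp
      then obtain a b where ab: "x = int p * a" "z = int p * b" by blast
      have "int p * (int p * (a\<^sup>2 + 3 * b\<^sup>2)) = int p * (int p * L)"
        using xz(3) unfolding ab L by (simp add: power2_eq_square algebra_simps)
      then have "(a, b) \<in> pos_reps L"
        using xz P ab by (simp add: pos_reps_def zero_less_mult_iff)
      with w ab show "w \<in> (\<lambda>(x, z). (int p * x, int p * z)) ` pos_reps L"
        by force
    next
      fix w
      assume "w \<in> (\<lambda>(x, z). (int p * x, int p * z)) ` pos_reps L"
      then show "w \<in> pos_reps (int p * M)"
        using P by (auto simp: pos_reps_def L power2_eq_square algebra_simps)
    qed
    moreover have "inj_on (\<lambda>(x, z). (int p * x, int p * z)) (pos_reps L)"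
      using P by (auto simp: inj_on_def)
    ultimately show ?thesis
      using True P L by (simp add: card_image)
  next
    case False
    have "pos_reps (int p * M) = {}"
    proof (rule ccontr)
      assume "pos_reps (int p * M) \<noteq> {}"
      then obtain x z where xz: "x\<^sup>2 + 3 * z\<^sup>2 = int p * M"
        by (auto simp: pos_reps_def)
      then have "int p dvd x \<and> int p dvd z"
        by (intro inert_dvd p) simp
      then obtain a b where ab: "x = int p * a" "z = int p * b" by blast
      have "int p * M = int p * (int p * (a\<^sup>2 + 3 * b\<^sup>2))"
        using xz unfolding ab by (simp add: power2_eq_square algebra_simps)
      then have "M = int p * (a\<^sup>2 + 3 * b\<^sup>2)" using P by simp
      with False show False by simp
    qed
    with False show ?thesis by simp
  qed
qed

section \<open>Split primes\<close>

text \<open>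
  Write \<open>p = \<pi>\<pi>'\<close> in \<open>\<int>[\<surd>-3]\<close>. An element of norm \<open>pM\<close> is divisible by \<open>\<pi>\<close> or by its conjugate \<open>\<pi>'\<close>,
  and by both exactly if it is divisible by \<open>p\<close>; division by \<open>\<pi>\<close> or \<open>\<pi>'\<close> leaves an element of norm \<open>M\<close>.
\<close>

lemma card_reps_split:
  fixes p :: nat and u v :: int
  assumes p: "prime p" and uv: "int p = u\<^sup>2 + 3 * v\<^sup>2" and nd: "\<not> int p dvd 2 * u * v"
  shows "card (reps (int p * M)) + card (if int p dvd M then reps (M div int p) else {})
       = 2 * card (reps M)"
proof -
  \<comment> \<open>With \<open>\<pi> = u + v sqrt(-3)\<close>, \<open>I 1\<close> holds the
    multiples of \<open>\<pi>\<close> and \<open>I (-1)\<close> those of its conjugate. The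
    condition concerns the \<open>sqrt(-3)\<close> part of the element times the opposite
    conjugate.\<close>
  define I where "I s = {(x, z) \<in> reps (int p * M). int p dvd u * z - s * v * x}" for s
  have P: "prime (int p)" and P0: "int p > 0" using p prime_gt_0_nat by auto
  have Un: "reps (int p * M) = I 1 \<union> I (-1)"
  proof -
    have "int p dvd u * z - v * x \<or> int p dvd u * z + v * x" if "(x, z) \<in> reps (int p * M)" for x z
    proof -
      have "(u * z - v * x) * (u * z + v * x) = (u\<^sup>2 + 3 * v\<^sup>2) * z\<^sup>2 - v\<^sup>2 * (x\<^sup>2 + 3 * z\<^sup>2)"
        by (simp add: power2_eq_square algebra_simps)
      also have "\<dots> = int p * (z\<^sup>2 - v\<^sup>2 * M)"
        using that uv by (simp add: reps_def algebra_simps)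
      finally have "int p dvd (u * z - v * x) * (u * z + v * x)" by simp
      with P show ?thesis by (simp only: prime_dvd_mult_iff)
    qed
    then show ?thesis by (auto simp: I_def)
  qed
  \<comment> \<open>The map is multiplication by \<open>\<pi>\<close>; its inverse multiplies by the
    conjugate and divides by \<open>p\<close>.\<close>
  have I1: "I 1 = (\<lambda>(a, b). (u * a - 3 * v * b, v * a + u * b)) ` reps M"
  proof (intro equalityI subsetI)
    fix w
    assume "w \<in> I 1"
    then obtain x z where w: "w = (x, z)" and xz: "x\<^sup>2 + 3 * z\<^sup>2 = int p * M"
      and d: "int p dvd u * z - v * x"
      by (auto simp: I_def reps_def)
    from d obtain b where b: "u * z - v * x = int p * b" by blast
    \<comment> \<open>Multiplicativity of the norm extends divisibility by \<open>p\<close> from the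
      \<open>sqrt(-3)\<close> part to the rational part.\<close>
    have "(u * x + 3 * v * z)\<^sup>2 = (u\<^sup>2 + 3 * v\<^sup>2) * (x\<^sup>2 + 3 * z\<^sup>2) - 3 * (u * z - v * x)\<^sup>2"
      by (simp add: power2_eq_square algebra_simps)
    also have "\<dots> = int p * (int p * M - 3 * (int p * b\<^sup>2))"
      unfolding uv[symmetric] xz b by (simp add: power2_eq_square algebra_simps)
    finally have "int p dvd (u * x + 3 * v * z)\<^sup>2" by simp
    with P have "int p dvd u * x + 3 * v * z" by (rule prime_dvd_power)
    then obtain a where a: "u * x + 3 * v * z = int p * a" by blast
    have "int p * int p * (a\<^sup>2 + 3 * b\<^sup>2) = (int p * a)\<^sup>2 + 3 * (int p * b)\<^sup>2"
      by (simp add: power2_eq_square algebra_simps)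
    also have "\<dots> = (u\<^sup>2 + 3 * v\<^sup>2) * (x\<^sup>2 + 3 * z\<^sup>2)"
      unfolding a[symmetric] b[symmetric] by (simp add: power2_eq_square algebra_simps)
    also have "\<dots> = int p * int p * M"
      unfolding uv[symmetric] xz by simp
    finally have "int p * int p * (a\<^sup>2 + 3 * b\<^sup>2) = int p * int p * M" .
    then have "(a, b) \<in> reps M" using P0 by (simp add: reps_def)
    moreover have "int p * x = int p * (u * a - 3 * v * b)"
    proof -
      have "int p * x = u * (u * x + 3 * v * z) - 3 * v * (u * z - v * x)"
        unfolding uv by (simp add: power2_eq_square algebra_simps)
      then show ?thesis unfolding a b by (simp add: algebra_simps)
    qed
    moreover have "int p * z = int p * (v * a + u * b)"
    proof -
      have "int p * z = v * (u * x + 3 * v * z) + u * (u * z - v * x)"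
        unfolding uv by (simp add: power2_eq_square algebra_simps)
      then show ?thesis unfolding a b by (simp add: algebra_simps)
    qed
    ultimately have "(a, b) \<in> reps M" "x = u * a - 3 * v * b" "z = v * a + u * b" using P0 by simp_all
    then show "w \<in> (\<lambda>(a, b). (u * a - 3 * v * b, v * a + u * b)) ` reps M"
      using w by force
  next
    fix w
    assume "w \<in> (\<lambda>(a, b). (u * a - 3 * v * b, v * a + u * b)) ` reps M"
    then obtain a b where w: "w = (u * a - 3 * v * b, v * a + u * b)" and ab: "a\<^sup>2 + 3 * b\<^sup>2 = M"
      by (auto simp: reps_def)
    have "(u * a - 3 * v * b)\<^sup>2 + 3 * (v * a + u * b)\<^sup>2 = int p * M"
      unfolding uv ab[symmetric] by (simp add: power2_eq_square algebra_simps)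
    moreover have "u * (v * a + u * b) - 1 * v * (u * a - 3 * v * b) = int p * b"
      unfolding uv by (simp add: power2_eq_square algebra_simps)
    ultimately show "w \<in> I 1" unfolding w I_def reps_def by simp
  qed
  have "inj_on (\<lambda>(a, b). (u * a - 3 * v * b, v * a + u * b)) (reps M)"
  proof (rule inj_onI, clarify)
    fix a b a' b' :: int
    assume *: "u * a - 3 * v * b = u * a' - 3 * v * b'" "v * a + u * b = v * a' + u * b'"
    have "int p * a = u * (u * a - 3 * v * b) + 3 * v * (v * a + u * b)"
      "int p * b = u * (v * a + u * b) - v * (u * a - 3 * v * b)" for a b
      unfolding uv by (simp_all add: power2_eq_square algebra_simps)
    with * have "int p * a = int p * a'" "int p * b = int p * b'"
      by metis+
    then show "a = a' \<and> b = b'" using P0 by simp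
  qed
  with I1 have c1: "card (I 1) = card (reps M)" by (simp add: card_image)
  \<comment> \<open>Conjugation exchanges the two sets.\<close>
  have "I (-1) = (\<lambda>(x, z). (x, -z)) ` I 1"
  proof (intro equalityI subsetI)
    fix w
    assume "w \<in> I (-1)"
    then obtain x z where w: "w = (x, z)" and xz: "(x, z) \<in> reps (int p * M)" "int p dvd u * z + v * x"
      by (auto simp: I_def)
    have "u * (-z) - v * x = - (u * z + v * x)" by simp
    with xz(2) have "int p dvd u * (-z) - v * x" by (simp only: dvd_minus_iff)
    with xz have "(x, -z) \<in> I 1" by (simp add: I_def reps_def)
    with w show "w \<in> (\<lambda>(x, z). (x, -z)) ` I 1" by force
  next
    fix w
    assume "w \<in> (\<lambda>(x, z). (x, -z)) ` I 1"
    then obtain x z where w: "w = (x, -z)" and xz: "(x, z) \<in> reps (int p * M)" "int p dvd u * z - v * x"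
      by (auto simp: I_def)
    have "u * (-z) - (-1) * v * x = - (u * z - v * x)" by simp
    with xz(2) have "int p dvd u * (-z) - (-1) * v * x" by (simp only: dvd_minus_iff)
    with xz w show "w \<in> I (-1)" by (simp add: I_def reps_def)
  qed
  moreover have "inj_on (\<lambda>(x, z). (x, - z)) (I 1)" by (auto simp: inj_on_def)
  ultimately have c2: "card (I (-1)) = card (reps M)" using c1 by (simp add: card_image)
  have fin: "finite (I s)" for s
    by (rule finite_subset[OF _ finite_reps[of "int p * M"]]) (auto simp: I_def)
  have ndu: "\<not> int p dvd 2" "\<not> int p dvd u" "\<not> int p dvd v" using nd by auto
  have dv: "int p dvd x \<and> int p dvd z" if "(x, z) \<in> I 1 \<inter> I (-1)" for x z
  proof -
    have d: "int p dvd u * z - v * x" "int p dvd u * z + v * x"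
      using that by (auto simp: I_def)
    have "int p dvd 2 * (u * z)" "int p dvd 2 * (v * x)"
      using dvd_add[OF d] dvd_diff[OF d(2,1)] by (simp_all add: algebra_simps)
    with P ndu show ?thesis by (metis prime_dvd_mult_iff)
  qed
  \<comment> \<open>Elements in both sets are \<open>p\<close> times an element of norm
    \<open>M / p\<close>.\<close>
  have sub: "\<exists>L a b. w = (int p * a, int p * b) \<and> M = int p * L \<and> (a, b) \<in> reps L"
    if "w \<in> I 1 \<inter> I (-1)" for w
  proof -
    obtain x z where w: "w = (x, z)" by (cases w)
    with dv that obtain a b where ab: "x = int p * a" "z = int p * b" by blast
    have "x\<^sup>2 + 3 * z\<^sup>2 = int p * M" using that w by (auto simp: I_def reps_def)
    then have "int p * M = int p * (int p * (a\<^sup>2 + 3 * b\<^sup>2))"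
      unfolding ab by (simp add: power2_eq_square algebra_simps)
    then have "M = int p * (a\<^sup>2 + 3 * b\<^sup>2)" using P0 by simp
    with w ab show ?thesis unfolding reps_def by blast
  qed
  have c3: "card (I 1 \<inter> I (-1)) = card (if int p dvd M then reps (M div int p) else {})"
  proof (cases "int p dvd M")
    case True
    then obtain L where L: "M = int p * L" by blast
    have "I 1 \<inter> I (-1) = (\<lambda>(a, b). (int p * a, int p * b)) ` reps L"
    proof (intro equalityI subsetI)
      fix w
      assume "w \<in> I 1 \<inter> I (-1)"
      from sub[OF this] L P0 show "w \<in> (\<lambda>(a, b). (int p * a, int p * b)) ` reps L" by auto
    next
      fix w
      assume "w \<in> (\<lambda>(a, b). (int p * a, int p * b)) ` reps L"
      then obtain a b where w: "w = (int p * a, int p * b)" and ab: "a\<^sup>2 + 3 * b\<^sup>2 = L"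
        by (auto simp: reps_def)
      have "(int p * a)\<^sup>2 + 3 * (int p * b)\<^sup>2 = int p * M"
        unfolding L ab[symmetric] by (simp add: power2_eq_square algebra_simps)
      then have "w \<in> I s" for s
        unfolding w I_def reps_def by simp
      then show "w \<in> I 1 \<inter> I (-1)" by blast
    qed
    moreover have "inj_on (\<lambda>(a, b). (int p * a, int p * b)) (reps L)"
      using P0 by (auto simp: inj_on_def)
    ultimately show ?thesis using True L P0 by (simp add: card_image)
  next
    case False
    have "I 1 \<inter> I (-1) = {}"
    proof (rule equals0I)
      fix w
      assume "w \<in> I 1 \<inter> I (-1)"
      from sub[OF this] False show False by auto
    qed
    with False show ?thesis by simp
  qed
  \<comment> \<open>Inclusion and exclusion for the union
    \<open>I 1 \<union> I (-1)\<close>.\<close>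
  show ?thesis
    using card_Un_Int[OF fin fin, of 1 "-1"] unfolding Un[symmetric] c1 c2 c3 by simp
qed

lemma square_mod_8: "(y::int)\<^sup>2 mod 8 \<in> {0, 1, 4}"
proof -
  have "y\<^sup>2 mod 8 = (y mod 8)\<^sup>2 mod 8" by (simp add: power_mod)
  moreover have "y mod 8 \<in> {0..7}" by simp
  then have "y mod 8 \<in> {0, 1, 2, 3, 4, 5, 6, 7}" by (simp only: atLeastAtMost_iff) auto
  ultimately show ?thesis by auto
qed

text \<open>\<open>x = 0\<close> would make \<open>N\<close> a multiple of 3, and
  \<open>z = 0\<close> would make it a square, which is 0, 1 or 4 modulo 8.\<close>

lemma reps_nonzero:
  assumes "N mod 3 = 1" "N mod 8 = 3 \<or> N mod 8 = 5 \<or> N mod 8 = 7" "(x, z) \<in> reps N"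
  shows "x \<noteq> 0 \<and> z \<noteq> 0"
proof -
  have N: "N = x\<^sup>2 + 3 * z\<^sup>2" using assms(3) by (simp add: reps_def)
  have "x \<noteq> 0"
    using assms(1) unfolding N by auto
  moreover have "z \<noteq> 0"
    using assms(2) square_mod_8[of x] unfolding N by auto
  ultimately show ?thesis by simp
qed

text \<open>The residues exclude zero coordinates for \<open>p M\<close>, \<open>M\<close> and
  \<open>M / p\<close>, so \<open>card_reps_split\<close> may be divided by 4: the two counts add up
  to an even number.\<close>

lemma pos_reps_split:
  fixes p :: nat and u v :: int
  assumes p: "prime p" and uv: "int p = u\<^sup>2 + 3 * v\<^sup>2" and nd: "\<not> int p dvd 2 * u * v"
    and M: "M mod 3 = 1" "M mod 8 = 3 \<or> M mod 8 = 7"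
    and pM: "int p * M mod 24 = 13" and L: "int p dvd M \<Longrightarrow> M div int p mod 24 = 13"
  shows "[int (card (pos_reps (int p * M))) =
          int (if int p dvd M then card (pos_reps (M div int p)) else 0)] (mod 2)"
proof -
  have 13: "card (reps N) = 4 * card (pos_reps N)" if "N mod 24 = 13" for N
  proof -
    from that have "N mod 3 = 1" "N mod 8 = 5" by presburger+
    then show ?thesis by (intro card_reps reps_nonzero[of N]) auto
  qed
  have parity: "[int a = int b] (mod 2)" if "a + b = 2 * c" for a b c :: nat
    using that unfolding cong_def by presburger
  have "card (reps M) = 4 * card (pos_reps M)"
    using M by (intro card_reps reps_nonzero[of M]) auto
  with card_reps_split[OF p uv nd, of M] 13[OF pM] 13[OF L]
  have "card (pos_reps (int p * M)) + (if int p dvd M then card (pos_reps (M div int p)) else 0)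
      = 2 * card (pos_reps M)"
    by (simp split: if_splits)
  then show ?thesis by (rule parity)
qed

subsection \<open>Congruences for \<^const>\<open>EO_u\<close>\<close>

text \<open>Modulo 4 the coefficient is twice the number of pairs \<open>(j, m)\<close> with
  \<open>m > 0\<close> and \<open>4 pent j + 2 m^2 = 4 n + 2\<close>. Multiplying by 6 and adding 1
  gives \<open>(6 j - 1)^2 + 3 (2 m)^2 = 24 n + 13\<close>.\<close>

lemma EO_u_cong_card_pos_reps:
  "[EO_u (4 * n + 2) = 2 * int (card (pos_reps (24 * int n + 13)))] (mod 4)"
proof -
  define N where "N = 4 * n + 2"
  define C where "C i = {j. 4 * pent j = i}" for i
  define D where "D i = {m :: nat. m > 0 \<and> i = 2 * m\<^sup>2}" for i
  define \<Theta> where "\<Theta> = Abs_fps (\<lambda>n. of_bool (\<exists>m>0. n = 2 * m\<^sup>2) :: int)"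
  define W where "W = {(j, m). m > 0 \<and> 4 * pent j + 2 * m\<^sup>2 = N}"
  have finC: "finite (C i)" for i
  proof (rule finite_subset)
    show "C i \<subseteq> {- int i..int i}"
    proof
      fix j
      assume "j \<in> C i"
      with abs_le_pent[of j] show "j \<in> {- int i..int i}"
        unfolding C_def atLeastAtMost_iff mem_Collect_eq by linarith
    qed
  qed simp
  have D_sing: "D (2 * m\<^sup>2) = {m}" if "m > 0" for m
    using that by (auto simp: D_def)
  \<comment> \<open>\<open>D i\<close> has at most one element, so its cardinality is the 0-1
    coefficient of \<open>\<Theta>\<close>.\<close>
  have D: "finite (D i) \<and> fps_nth \<Theta> i = int (card (D i))" for i
  proof (cases "\<exists>m>0. i = 2 * m\<^sup>2")
    case True
    then show ?thesis using D_sing by (auto simp: \<Theta>_def)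
  next
    case False
    then have "D i = {}" by (auto simp: D_def)
    with False show ?thesis by (auto simp: \<Theta>_def)
  qed
  have C_cong: "[fps_nth (euler_f 4) i = int (card (C i))] (mod 2)" for i
  proof -
    have "[(\<Sum>j\<in>C i. (-1) ^ nat \<bar>j\<bar>) = (\<Sum>j\<in>C i. 1 :: int)] (mod 2)"
      by (intro cong_sum) (simp add: cong_def minus_one_power_iff)
    then show ?thesis by (simp add: euler_f_nth C_def)
  qed
  \<comment> \<open>\<open>f_4\<close> has only exponents divisible by 4, unlike
    \<open>N = 4 n + 2\<close>.\<close>
  have "C N = {}" by (auto simp: C_def N_def) presburger
  then have f4N: "fps_nth (euler_f 4) N = 0" by (simp add: euler_f_nth C_def)
  have "[EO_u N = fps_nth (euler_f 4 * (1 + 2 * \<Theta>)) N] (mod 4)"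
    using EO_u_cong by (simp add: fps_cong_def \<Theta>_def)
  also have "euler_f 4 * (1 + 2 * \<Theta>) = euler_f 4 + 2 * (euler_f 4 * \<Theta>)"
    by (simp add: algebra_simps)
  also have "fps_nth \<dots> N = 2 * (\<Sum>i=0..N. fps_nth (euler_f 4) i * fps_nth \<Theta> (N - i))"
    unfolding numeral_fps_const fps_add_nth fps_mult_left_const_nth f4N
    by (simp only: fps_mult_nth add_0_left)
  also have "[\<dots> = 2 * (\<Sum>i=0..N. int (card (C i)) * int (card (D (N - i))))] (mod 4)"
  proof -
    have "[(\<Sum>i=0..N. fps_nth (euler_f 4) i * fps_nth \<Theta> (N - i))
        = (\<Sum>i=0..N. int (card (C i)) * int (card (D (N - i))))] (mod 2)"
      unfolding D[THEN conjunct2] by (intro cong_sum cong_mult C_cong cong_refl)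
    then show ?thesis by (rule cong_double)
  qed
  also have "(\<Sum>i=0..N. int (card (C i)) * int (card (D (N - i)))) = int (card W)"
  proof -
    have "W = (\<Union>i\<in>{0..N}. C i \<times> D (N - i))"
      by (auto simp: W_def C_def D_def)
    moreover have "card (\<Union>i\<in>{0..N}. C i \<times> D (N - i)) = (\<Sum>i=0..N. card (C i \<times> D (N - i)))"
      by (rule card_UN_disjoint) (auto simp: finC D, auto simp: C_def)
    ultimately show ?thesis by (simp add: card_cartesian_product)
  qed
  also have "card W = card (pos_reps (24 * int n + 13))"
  proof (rule bij_betw_same_card)
    have sq: "(6 * j - 1)\<^sup>2 = 24 * int (pent j) + 1" for j
      using two_pent[of j] by (simp add: power2_eq_square algebra_simps)
    let ?f = "\<lambda>(j :: int, m :: nat). (\<bar>6 * j - 1\<bar>, 2 * int m)"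
    have W_iff: "(j, m) \<in> W \<longleftrightarrow> m > 0 \<and> (6 * j - 1)\<^sup>2 + 3 * (2 * int m)\<^sup>2 = 24 * int n + 13" for j m
    proof -
      have "4 * pent j + 2 * m\<^sup>2 = N \<longleftrightarrow> 4 * int (pent j) + 2 * (int m)\<^sup>2 = 4 * int n + 2"
        unfolding N_def of_nat_power[symmetric] by linarith
      then show ?thesis unfolding W_def sq by auto
    qed
    have "inj_on ?f W"
    proof (rule inj_onI, clarify)
      fix j j' :: int and m m' :: nat
      assume "\<bar>6 * j - 1\<bar> = \<bar>6 * j' - 1\<bar>" "2 * int m = 2 * int m'"
      \<comment> \<open>Opposite signs are impossible: \<open>6 j - 1\<close> is -1 modulo 6, its
        negative is 1.\<close>
      then show "j = j' \<and> m = m'" by presburger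
    qed
    moreover have "?f ` W \<subseteq> pos_reps (24 * int n + 13)"
    proof clarify
      fix j m
      assume "(j, m) \<in> W"
      moreover have "\<bar>6 * j - 1\<bar> > 0" by presburger
      ultimately show "(\<bar>6 * j - 1\<bar>, 2 * int m) \<in> pos_reps (24 * int n + 13)"
        by (simp add: W_iff pos_reps_def)
    qed
    moreover have "pos_reps (24 * int n + 13) \<subseteq> ?f ` W"
    proof clarify
      fix x z
      assume "(x, z) \<in> pos_reps (24 * int n + 13)"
      then have xz: "x > 0" "z > 0" "x\<^sup>2 + 3 * z\<^sup>2 = 24 * int n + 13"
        by (auto simp: pos_reps_def)
      \<comment> \<open>Modulo 8 forces \<open>x\<close> odd and \<open>z\<close> even, and modulo 3
        excludes \<open>3 dvd x\<close>. So \<open>x\<close> is 1 or -1 modulo 6, which supplies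
        \<open>j\<close>.\<close>
      have "(x\<^sup>2 + 3 * z\<^sup>2) mod 8 = 5" unfolding xz(3) by presburger
      moreover have "odd a \<and> even b"
        if "a mod 8 \<in> {0, 1, 4}" "b mod 8 \<in> {0, 1, 4}" "(a + 3 * b) mod 8 = 5" for a b :: int
      proof -
        have "(a mod 8 + 3 * (b mod 8)) mod 8 = 5"
          using that(3) by (metis mod_add_left_eq mod_add_right_eq mod_mult_right_eq)
        with that(1,2) have "a mod 8 = 1" "b mod 8 = 4" by auto
        then show ?thesis by presburger
      qed
      ultimately have "odd (x\<^sup>2) \<and> even (z\<^sup>2)"
        using square_mod_8 by blast
      then have "odd x" "even z" by simp_all
      have "\<not> 3 dvd x"
      proof
        assume "3 dvd x"
        then have "3 dvd x\<^sup>2 + 3 * z\<^sup>2" by (simp add: power2_eq_square)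
        then show False unfolding xz(3) by presburger
      qed
      with \<open>odd x\<close> have "6 dvd x + 1 \<or> 6 dvd 1 - x" by presburger
      then obtain j where j: "6 * j = x + 1 \<or> 6 * j = 1 - x" by (metis dvdE)
      obtain m where m: "z = 2 * m" using \<open>even z\<close> by blast
      from j have jx: "\<bar>6 * j - 1\<bar> = x" using xz(1) by linarith
      then have "(6 * j - 1)\<^sup>2 = x\<^sup>2" by (metis power2_abs)
      then have "(j, nat m) \<in> W" using xz m by (simp add: W_iff)
      then show "(x, z) \<in> ?f ` W"
        using jx m xz(2) by (intro rev_image_eqI[of "(j, nat m)"]) simp_all
    qed
    ultimately show "bij_betw ?f W (pos_reps (24 * int n + 13))"
      by (simp add: bij_betw_def subset_antisym)
  qed
  finally show ?thesis unfolding N_def .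
qed

section \<open>Passage to the arithmetic progressions\<close>

text \<open>For \<open>M = 24 n + s\<close>, \<open>ps\<close> gives
  \<open>p M = 24 (p n + r) + 13\<close>, the left index, and \<open>ms\<close> gives
  \<open>M = 24 (n - m) + 13 p\<close>. So \<open>p\<close> divides \<open>M\<close> exactly if it
  divides \<open>n - m\<close>, and \<open>M / p\<close> is then attached to the index
  \<open>(n - m) / p\<close> on the right.\<close>

lemma fps_cong_EO_u_progression:
  fixes p r m s :: nat
  assumes ps: "p * s = 24 * r + 13" and ms: "24 * m + s = 13 * p" and "m < p"
    and cop: "coprime p 24"
    and parity: "\<And>M. M mod 24 = int s mod 24 \<Longrightarrow> (int p dvd M \<Longrightarrow> M div int p mod 24 = 13) \<Longrightarrow>
      [int (card (pos_reps (int p * M)))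
        = int (if int p dvd M then card (pos_reps (M div int p)) else 0)] (mod 2)"
  shows "fps_cong 4 (Abs_fps (\<lambda>n. EO_u (4 * p * n + 4 * r + 2)))
           (fps_X ^ m * (Abs_fps (\<lambda>n. EO_u (4 * n + 2)) oo fps_X ^ p))"
  unfolding fps_cong_def
proof
  fix n
  define M where "M = 24 * int n + int s"
  have p0: "int p > 0" using \<open>m < p\<close> by simp
  have M: "M = 24 * (int n - int m) + 13 * int p"
    using arg_cong[OF ms, of int] by (simp add: M_def)
  have pM: "int p * M = 24 * int (p * n + r) + 13"
    using arg_cong[OF ps, of int] by (simp add: M_def algebra_simps)
  have dvd: "m \<le> n \<and> p dvd n - m" if "int p dvd M"
  proof -
    from that have "int p dvd (int n - int m) * 24"
      unfolding M by (simp add: dvd_add_left_iff mult.commute)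
    moreover have "coprime (int p) 24"
      using cop by (metis coprime_int_iff of_nat_numeral)
    ultimately have d: "int p dvd int n - int m"
      by (simp only: coprime_dvd_mult_left_iff)
    \<comment> \<open>For \<open>n < m\<close> the shifted series has coefficient 0; here
      \<open>0 < m - n < p\<close> rules out divisibility.\<close>
    have "m \<le> n"
    proof (rule ccontr)
      assume "\<not> m \<le> n"
      then have "int m - int n > 0" "int m - int n < int p" using \<open>m < p\<close> by simp_all
      moreover have "int p dvd int m - int n" using d by (simp add: dvd_diff_commute)
      ultimately show False using zdvd_not_zless by blast
    qed
    moreover from this d have "p dvd n - m" by (metis int_dvd_int_iff of_nat_diff)
    ultimately show ?thesis by simp
  qed
  have quot: "int p dvd M \<and> M div int p = 24 * int ((n - m) div p) + 13" if "m \<le> n" "p dvd n - m"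
  proof -
    from that obtain k where k: "n - m = p * k" by blast
    then have "int n - int m = int p * int k" using that(1) by (metis of_nat_diff of_nat_mult)
    then have "M = int p * (24 * int k + 13)" unfolding M by (simp add: algebra_simps)
    then show ?thesis using k p0 by simp
  qed
  have "[EO_u (4 * (p * n + r) + 2) = 2 * int (card (pos_reps (int p * M)))] (mod 4)"
    unfolding pM by (rule EO_u_cong_card_pos_reps)
  also have "[2 * int (card (pos_reps (int p * M)))
      = 2 * int (if int p dvd M then card (pos_reps (M div int p)) else 0)] (mod 4)"
  proof (intro cong_double parity)
    show "M mod 24 = int s mod 24" by (simp add: M_def)
    show "M div int p mod 24 = 13" if "int p dvd M"
      using quot dvd[OF that] by simp
  qed
  also have "[2 * int (if int p dvd M then card (pos_reps (M div int p)) else 0)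
      = fps_nth (fps_X ^ m * (Abs_fps (\<lambda>n. EO_u (4 * n + 2)) oo fps_X ^ p)) n] (mod 4)"
  proof (cases "int p dvd M")
    case True
    with dvd quot have *: "m \<le> n" "p dvd n - m" "M div int p = 24 * int ((n - m) div p) + 13" by auto
    have "[EO_u (4 * ((n - m) div p) + 2) = 2 * int (card (pos_reps (M div int p)))] (mod 4)"
      unfolding *(3) by (rule EO_u_cong_card_pos_reps)
    moreover have "fps_nth (fps_X ^ m * (Abs_fps (\<lambda>n. EO_u (4 * n + 2)) oo fps_X ^ p)) n
        = EO_u (4 * ((n - m) div p) + 2)"
      using *(1,2) by (simp add: fps_X_power_mult_nth fps_nth_compose_X_power)
    ultimately show ?thesis
      using True by (simp only: if_True cong_sym_eq)
  next
    case False
    with quot show ?thesis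
      by (auto simp: fps_X_power_mult_nth fps_nth_compose_X_power)
  qed
  finally show "[fps_nth (Abs_fps (\<lambda>n. EO_u (4 * p * n + 4 * r + 2))) n
      = fps_nth (fps_X ^ m * (Abs_fps (\<lambda>n. EO_u (4 * n + 2)) oo fps_X ^ p)) n] (mod 4)"
    by (simp add: algebra_simps)
qed

theorem theorem4p1:
  fixes p r m :: nat
  assumes "(p, r, m) \<in> {(5, 3, 2), (7, 5, 3), (11, 10, 5), (17, 3, 9), (19, 5, 10),
                         (23, 10, 12), (29, 20, 15)}"
  shows "fps_cong 4 (Abs_fps (\<lambda>n. EO_u (4 * p * n + 4 * r + 2)))
           (fps_X ^ m * (Abs_fps (\<lambda>n. EO_u (4 * n + 2)) oo fps_X ^ p))"
proof -
  \<comment> \<open>The value forced by \<open>24 m + s = 13 p\<close>; the given \<open>r\<close>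
    satisfies \<open>p s = 24 r + 13\<close>.\<close>
  define s where "s = 13 * p - 24 * m"
  have arith: "p * s = 24 * r + 13" "24 * m + s = 13 * p" "m < p"
    using assms by (auto simp: s_def)
  have p: "prime p"
    using assms by auto
  have "\<not> p dvd 24"
    using assms by auto
  then have cop: "coprime p 24"
    by (rule prime_imp_coprime[OF p])
  \<comment> \<open>The first five primes are 2 modulo 3, hence inert; 7 and 19 split as
    \<open>2^2 + 3\<close> and \<open>4^2 + 3\<close>.\<close>
  from assms consider "p \<in> {5, 11, 17, 23, 29}" | "p = 7" "s = 19" | "p = 19" "s = 7"
    by (auto simp: s_def)
  then show ?thesis
  proof cases
    case 1
    then have "p mod 3 = 2" "p > 2" by auto
    then show ?thesis
      by (intro fps_cong_EO_u_progression[OF arith cop]) (simp only: pos_reps_inert[OF p] cong_refl)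
  next
    case 2
    have "int p = 2\<^sup>2 + 3 * 1\<^sup>2" "\<not> int p dvd 2 * 2 * 1" using 2 by simp_all
    note split = pos_reps_split[OF p this]
    show ?thesis
    proof (rule fps_cong_EO_u_progression[OF arith cop], rule split)
      fix M
      assume "M mod 24 = int s mod 24"
      with 2 have M: "M mod 24 = 19" by simp
      then show "M mod 3 = 1" "M mod 8 = 3 \<or> M mod 8 = 7" by presburger+
      have "int p * M mod 24 = int p * (M mod 24) mod 24"
        by (simp only: mod_mult_right_eq)
      with 2 M show "int p * M mod 24 = 13" by simp
    qed
  next
    case 3
    have "int p = 4\<^sup>2 + 3 * 1\<^sup>2" "\<not> int p dvd 2 * 4 * 1" using 3 by simp_all
    note split = pos_reps_split[OF p this]
    show ?thesis
    proof (rule fps_cong_EO_u_progression[OF arith cop], rule split)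
      fix M
      assume "M mod 24 = int s mod 24"
      with 3 have M: "M mod 24 = 7" by simp
      then show "M mod 3 = 1" "M mod 8 = 3 \<or> M mod 8 = 7" by presburger+
      have "int p * M mod 24 = int p * (M mod 24) mod 24"
        by (simp only: mod_mult_right_eq)
      with 3 M show "int p * M mod 24 = 13" by simp
    qed
  qed
qed

end
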